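(* Let $H,\hat H\in\mathbb{R}^{M\times N}$, let $R$ be the rank of $\hat H$, let $D:=\frac{\partial\mu}{\partial p}\in\mathbb{R}^{N\times N_p}$ be of full rank, and assume $N_p\le R$. Put $J=-HD$, $\bar J=-\hat H D$ and $E_J=J-\bar J$. Let $\varepsilon\in\mathbb{R}^M$ and $\nu>0$, and let $\delta p,\delta\bar p\in\mathbb{R}^{N_p}$ be the search directions defined by $$(J^TJ+\nu I)\,\delta p=-J^T\varepsilon,\qquad (\bar J^T\bar J+\nu I)\,\delta\bar p=-\bar J^T\varepsilon .$$ Let $\bar\sigma_1$ and $\bar\sigma_{N_p}$ (with $0\le\bar\sigma_{N_p}\le\bar\sigma_1$) be, respectively, an upper and a lower bound for the singular values of $J$, i.e. every singular value $\sigma_i(J)$, $i=1,\dots,N_p$, satisfies $\bar\sigma_{N_p}\le\sigma_i(J)\le\bar\sigma_1$. Then $$\|\delta p-\delta\bar p\|_2\le\left[\eta(\nu)\,\|\delta\bar p\|_2+\frac{\|\varepsilon\|_2}{\nu+\bar\sigma_{N_p}^2}\right]\|E_J\|_2,\qquad \eta(\nu)=\max_{\bar\sigma_{N_p}\le\sigma\le\bar\sigma_1}\frac{\sigma}{\nu+\sigma^2}.$$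
   Context: Here $\|\cdot\|_2$ is the Euclidean vector norm and the induced spectral matrix norm. $H$ is the (weighted) measurement operator of a linearized inverse problem, $\hat H$ is a low-rank approximation of it, $p\in\mathbb{R}^{N_p}$ are shape parameters, $\mu(p)\in\mathbb{R}^N$ is the discretized shape, and $\varepsilon=y-H\mu(p)$ is the residual of the nonlinear least-squares problem $\min_p\|y-H\mu(p)\|_2^2$ with data $y\in\mathbb{R}^M$. $J=\partial\varepsilon/\partial p$ is the exact Jacobian, $\bar J$ is the approximate Jacobian, and $\delta p,\delta\bar p$ are the corresponding Levenberg-Marquardt search directions with parameter $\nu$, computed with the same residual $\varepsilon$. The $N_p$ singular values of $J$ are the square roots of the eigenvalues of $J^TJ$. *)

theory Defs
  imports "HOL-Analysis.Analysis"
begin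

(* The spectral norm: operator norm with respect to the Euclidean norms. *)
definition spectral_norm :: "real^'n^'m \<Rightarrow> real"
  where "spectral_norm A = onorm (\<lambda>x. A *v x)"

definition is_eigenvalue :: "real^'n^'n \<Rightarrow> real \<Rightarrow> bool"
  where "is_eigenvalue A l \<longleftrightarrow> (\<exists>v. v \<noteq> 0 \<and> A *v v = l *\<^sub>R v)"

(* The values sigma_i(A), one for each eigenvalue of A^T A (so zero is included when the columns
   of A are dependent).  As a set this does not record multiplicities. *)
definition singular_values :: "real^'n^'m \<Rightarrow> real set"
  where "singular_values A = {sqrt l | l. is_eigenvalue (transpose A ** A) l}"

(* The maximum over the whole interval [a, b].  Max only makes sense for finite sets, hence
   Greatest; the maximum is attained by lemma eta_max below. *)
definition eta :: "real \<Rightarrow> real \<Rightarrow> real \<Rightarrow> real"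
  where "eta a b \<nu> = (GREATEST r. r \<in> (\<lambda>\<sigma>. \<sigma> / (\<nu> + \<sigma>\<^sup>2)) ` {a..b})"

lemma eta_max:
  assumes "a \<le> b" "\<nu> > 0"
  shows "eta a b \<nu> \<in> (\<lambda>\<sigma>. \<sigma> / (\<nu> + \<sigma>\<^sup>2)) ` {a..b}"
    and "\<And>\<sigma>. a \<le> \<sigma> \<Longrightarrow> \<sigma> \<le> b \<Longrightarrow> \<sigma> / (\<nu> + \<sigma>\<^sup>2) \<le> eta a b \<nu>"
proof -
  let ?f = "\<lambda>\<sigma>::real. \<sigma> / (\<nu> + \<sigma>\<^sup>2)"
  have nz: "\<nu> + \<sigma>\<^sup>2 \<noteq> 0" for \<sigma> :: real
    using assms(2) zero_le_power2[of \<sigma>] by linarith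
  have "continuous_on {a..b} ?f"
    by (intro continuous_intros) (simp add: nz)
  then obtain s where s: "s \<in> {a..b}" "\<forall>\<sigma>\<in>{a..b}. ?f \<sigma> \<le> ?f s"
    using continuous_attains_sup[of "{a..b}" ?f] assms(1) by auto
  have eq: "eta a b \<nu> = ?f s"
    unfolding eta_def using s by (intro Greatest_equality) auto
  show "eta a b \<nu> \<in> ?f ` {a..b}"
    using s(1) eq by auto
  show "\<And>\<sigma>. a \<le> \<sigma> \<Longrightarrow> \<sigma> \<le> b \<Longrightarrow> ?f \<sigma> \<le> eta a b \<nu>"
    using s(2) eq by auto
qed

end

theory Submission
  imports Defs
begin

text \<open>
  Let \<open>A = J\<^sup>T J + \<nu> I\<close> and \<open>r = \<epsilon> + Jbar \<delta>pbar\<close>. Subtracting the two normal equations gives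
  \<open>A (\<delta>p - \<delta>pbar) = - (E\<^sup>T r + J\<^sup>T E \<delta>pbar)\<close>, and the normal equation for \<open>\<delta>pbar\<close> gives
  \<open>\<parallel>r\<parallel> \<le> \<parallel>\<epsilon>\<parallel>\<close>. Choosing \<open>z\<close> with \<open>A z = \<delta>p - \<delta>pbar\<close> and using the symmetry of \<open>A\<close>,
  \<open>\<parallel>\<delta>p - \<delta>pbar\<parallel>\<^sup>2 = - r \<bullet> E z - E \<delta>pbar \<bullet> J z\<close>, so it remains to bound \<open>\<parallel>z\<parallel>\<close> and \<open>\<parallel>J z\<parallel>\<close> by
  multiples of \<open>\<parallel>A z\<parallel>\<close>. Both bounds say that a quadratic polynomial in \<open>J\<^sup>T J\<close> is positive
  semidefinite, which is checked on the eigenvalues of \<open>J\<^sup>T J\<close>.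
\<close>

text \<open>The Rayleigh quotient attains its minimum \<open>m\<close> on the unit sphere of
  \<open>V\<close>, and its first variation vanishes at a minimiser \<open>v\<close>, so
  \<open>v\<close> is an eigenvector. Working in an invariant subspace rather than the whole space
  allows a second use inside an eigenspace of another map.\<close>

lemma self_adjoint_min_eigenvector:
  fixes f :: "'a::euclidean_space \<Rightarrow> 'a"
  assumes f: "linear f" and sa: "\<And>x y. f x \<bullet> y = x \<bullet> f y"
    and V: "subspace V" "V \<noteq> {0}" and inv: "\<And>x. x \<in> V \<Longrightarrow> f x \<in> V"
  obtains v m where "v \<in> V" "v \<noteq> 0" "f v = m *\<^sub>R v"
    "\<And>z. z \<in> V \<Longrightarrow> m * (z \<bullet> z) \<le> z \<bullet> f z"
proof -
  let ?S = "V \<inter> sphere 0 1"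
  have "compact ?S"
    using closed_subspace[OF V(1)] by (simp add: closed_Int_compact)
  moreover obtain x where x: "x \<in> V" "x \<noteq> 0"
    using V subspace_0 by blast
  then have "x /\<^sub>R norm x \<in> ?S"
    using V(1) by (simp add: subspace_scale)
  then have "?S \<noteq> {}" by blast
  moreover have "continuous_on ?S (\<lambda>z. z \<bullet> f z)"
    using f by (intro continuous_intros linear_continuous_on)
      (simp add: linear_conv_bounded_linear)
  ultimately obtain v where v: "v \<in> ?S" and min: "\<And>z. z \<in> ?S \<Longrightarrow> v \<bullet> f v \<le> z \<bullet> f z"
    using continuous_attains_inf[of ?S "\<lambda>z. z \<bullet> f z"] by blast
  define m where "m = v \<bullet> f v"
  have vv: "v \<bullet> v = 1" and vV: "v \<in> V"
    using v by (auto simp: dot_square_norm)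
  have low: "m * (z \<bullet> z) \<le> z \<bullet> f z" if z: "z \<in> V" for z
  proof (cases "z = 0")
    case False
    have "z /\<^sub>R norm z \<in> ?S"
      using False V(1) z by (simp add: subspace_scale)
    from min[OF this] have "m \<le> (z \<bullet> f z) / (norm z)\<^sup>2"
      by (simp add: m_def linear_scale[OF f] power2_eq_square field_simps)
    then show ?thesis
      using False by (simp add: dot_square_norm field_simps)
  qed (simp add: linear_0[OF f])
  define w where "w = f v - m *\<^sub>R v"
  define g where "g z = z \<bullet> f z - m * (z \<bullet> z)" for z
  have wV: "w \<in> V"
    unfolding w_def using vV inv V(1) by (simp add: subspace_diff subspace_scale)
  have "w = 0"
  proof (rule ccontr)
    assume "w \<noteq> 0"
    then have c: "w \<bullet> w > 0" by simp
    have k: "g w \<ge> 0" unfolding g_def using low[OF wV] by simp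
    \<comment> \<open>\<open>g\<close> is nonnegative on \<open>V\<close> and zero at
      \<open>v\<close>, so a step from \<open>v\<close> along \<open>w\<close> with negative
      \<open>t\<close> must not make it negative. The minimiser of the quadratic in \<open>t\<close>
      would be \<open>- (w \<bullet> w) / g w\<close>; adding 1 to the denominator covers
      \<open>g w = 0\<close> and still gives a negative value.\<close>
    define t where "t = - (w \<bullet> w) / (g w + 1)"
    have "v + t *\<^sub>R w \<in> V"
      using vV wV V(1) by (simp add: subspace_add subspace_scale)
    then have "0 \<le> g (v + t *\<^sub>R w)"
      unfolding g_def using low by simp
    also have "g (v + t *\<^sub>R w) = 2 * t * (w \<bullet> (f v - m *\<^sub>R v)) + t\<^sup>2 * g w"
      using sa[of v w] vv
      by (simp add: g_def m_def linear_add[OF f] linear_scale[OF f] inner_simps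
          inner_commute power2_eq_square algebra_simps)
    also have "\<dots> = t * (2 * (w \<bullet> w) + t * g w)"
      by (simp add: w_def[symmetric] power2_eq_square algebra_simps)
    also have "2 * (w \<bullet> w) + t * g w = (w \<bullet> w) * (g w + 2) / (g w + 1)"
      using k by (simp add: t_def field_simps)
    finally have "0 \<le> t * ((w \<bullet> w) * (g w + 2) / (g w + 1))" .
    moreover have "t < 0" "(w \<bullet> w) * (g w + 2) / (g w + 1) > 0"
      using c k by (auto simp: t_def)
    ultimately show False
      by (smt (verit) mult_neg_pos)
  qed
  then show thesis
    using that[of v m] vV vv low unfolding w_def by fastforce
qed

text \<open>The quadratic in \<open>f\<close> is a self-adjoint map \<open>q\<close> commuting with
  \<open>f\<close>. Its least eigenvalue is therefore the value of the polynomial at some eigenvalue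
  of \<open>f\<close>, so no full diagonalisation is used.\<close>

lemma self_adjoint_quadratic_nonneg:
  fixes f :: "'a::euclidean_space \<Rightarrow> 'a"
  assumes f: "linear f" and sa: "\<And>x y. f x \<bullet> y = x \<bullet> f y"
    and ev: "\<And>l v. v \<noteq> 0 \<Longrightarrow> f v = l *\<^sub>R v \<Longrightarrow> 0 \<le> a * l\<^sup>2 + b * l + c"
  shows "0 \<le> a * (f z \<bullet> f z) + b * (z \<bullet> f z) + c * (z \<bullet> z)"
proof -
  define q where "q x = a *\<^sub>R f (f x) + b *\<^sub>R f x + c *\<^sub>R x" for x
  have q: "linear q"
    unfolding q_def
    by (intro linearI) (simp_all add: linear_add[OF f] linear_scale[OF f] algebra_simps)
  have q_sa: "q x \<bullet> y = x \<bullet> q y" for x y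
    by (simp add: q_def inner_simps sa)
  obtain u m where u: "u \<noteq> 0" "q u = m *\<^sub>R u"
    and low: "\<And>z. m * (z \<bullet> z) \<le> z \<bullet> q z"
    by (rule self_adjoint_min_eigenvector[OF q q_sa, of UNIV]) auto
  \<comment> \<open>The eigenspace of \<open>q\<close> is invariant under \<open>f\<close>, so it contains an eigenvector of \<open>f\<close>.\<close>
  let ?V = "{x. q x = m *\<^sub>R x}"
  have V: "subspace ?V"
    by (auto simp: subspace_def linear_0[OF q] linear_add[OF q] linear_scale[OF q] algebra_simps)
  have "q (f x) = f (q x)" for x
    by (simp add: q_def linear_add[OF f] linear_scale[OF f])
  then have inv: "f x \<in> ?V" if "x \<in> ?V" for x
    using that by (simp add: linear_scale[OF f])
  have "?V \<noteq> {0}" using u by blast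
  then obtain v l where v: "v \<in> ?V" "v \<noteq> 0" "f v = l *\<^sub>R v"
    using self_adjoint_min_eigenvector[OF f sa V _ inv] by metis
  have "q v = (a * l\<^sup>2 + b * l + c) *\<^sub>R v"
    using v(3) by (simp add: q_def linear_scale[OF f] power2_eq_square algebra_simps)
  with v(1,2) have "m = a * l\<^sup>2 + b * l + c"
    by simp
  then have "0 \<le> m" using ev[OF v(2,3)] by simp
  then have "0 \<le> z \<bullet> q z"
    using low[of z] by (meson inner_ge_zero mult_nonneg_nonneg order_trans)
  then show ?thesis
    by (simp add: q_def inner_simps sa)
qed

lemma inner_vector_matrix: "y \<bullet> (x v* A) = (A *v y) \<bullet> x"
  for A :: "real^'n^'m"
  by (metis dot_lmul_matrix inner_commute)

text \<open>Eigenvalues of the Gram matrix satisfy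
  \<open>l * (v \<bullet> v) = (J *v v) \<bullet> (J *v v)\<close>, hence are nonnegative and are
  exactly the squares of singular values.\<close>

lemma gram_quadratic_nonneg:
  fixes J :: "real^'p^'m"
  assumes "\<And>s. s \<in> singular_values J \<Longrightarrow> 0 \<le> s \<Longrightarrow> 0 \<le> a * (s\<^sup>2)\<^sup>2 + b * s\<^sup>2 + c"
  defines "f \<equiv> \<lambda>z. transpose J *v (J *v z)"
  shows "0 \<le> a * (norm (f z))\<^sup>2 + b * (norm (J *v z))\<^sup>2 + c * (norm z)\<^sup>2"
proof -
  have f_inner: "x \<bullet> f y = (J *v x) \<bullet> (J *v y)" for x y
    by (simp add: f_def inner_vector_matrix)
  have "linear f"
    unfolding f_def
    by (simp add: matrix_vector_mul_assoc matrix_vector_mul_linear)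
  moreover have "f x \<bullet> y = x \<bullet> f y" for x y
    using f_inner[of x y] f_inner[of y x] by (simp add: inner_commute)
  moreover have "0 \<le> a * l\<^sup>2 + b * l + c" if "v \<noteq> 0" "f v = l *\<^sub>R v" for l v
  proof -
    have "l * (v \<bullet> v) = (J *v v) \<bullet> (J *v v)"
      using f_inner[of v v] that(2) by simp
    then have "l \<ge> 0"
      using that(1) by (metis inner_ge_zero inner_gt_zero_iff zero_le_mult_iff not_le)
    moreover have "sqrt l \<in> singular_values J"
      using that by (auto simp: singular_values_def is_eigenvalue_def f_def matrix_vector_mul_assoc)
    ultimately show ?thesis
      using assms(1)[of "sqrt l"] by simp
  qed
  ultimately have "0 \<le> a * (f z \<bullet> f z) + b * (z \<bullet> f z) + c * (z \<bullet> z)"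
    by (rule self_adjoint_quadratic_nonneg)
  then show ?thesis
    by (simp add: f_inner power2_norm_eq_inner)
qed

lemma regularized_gram_vector:
  fixes J :: "real^'p^'m"
  shows "(transpose J ** J + \<nu> *\<^sub>R mat 1) *v z = transpose J *v (J *v z) + \<nu> *\<^sub>R z"
  by (simp add: matrix_vector_mult_add_rdistrib matrix_vector_mul_assoc
      scaleR_matrix_vector_assoc[symmetric])

lemma norm_regularized_gram_ge:
  fixes J :: "real^'p^'m"
  assumes s: "0 \<le> s" "\<forall>t \<in> singular_values J. s \<le> t"
  shows "(\<nu> + s\<^sup>2) * norm z \<le> norm ((transpose J ** J + \<nu> *\<^sub>R mat 1) *v z)"
proof -
  let ?A = "(transpose J ** J + \<nu> *\<^sub>R mat 1) *v z"
  \<comment> \<open>The polynomial is \<open>l - s\<^sup>2\<close> at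
    \<open>l = t\<^sup>2\<close>.\<close>
  have "0 \<le> 0 * (norm (transpose J *v (J *v z)))\<^sup>2 + 1 * (norm (J *v z))\<^sup>2 + (- s\<^sup>2) * (norm z)\<^sup>2"
    using s by (intro gram_quadratic_nonneg) (simp add: power_mono)
  then have "(\<nu> + s\<^sup>2) * (norm z)\<^sup>2 \<le> (norm (J *v z))\<^sup>2 + \<nu> * (norm z)\<^sup>2"
    by (simp add: algebra_simps)
  also have "\<dots> = z \<bullet> ?A"
    by (simp add: regularized_gram_vector inner_simps power2_norm_eq_inner
        inner_vector_matrix)
  also have "\<dots> \<le> norm z * norm ?A"
    by (rule norm_cauchy_schwarz)
  finally show ?thesis
    by (cases "z = 0") (auto simp: power2_eq_square mult.assoc mult.commute mult.left_commute)
qed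

lemma norm_le_regularized_gram:
  fixes J :: "real^'p^'m"
  assumes "\<nu> > 0" "0 \<le> h" "\<forall>s \<in> singular_values J. s / (\<nu> + s\<^sup>2) \<le> h"
  shows "norm (J *v z) \<le> h * norm ((transpose J ** J + \<nu> *\<^sub>R mat 1) *v z)"
proof -
  let ?g = "transpose J *v (J *v z)"
  \<comment> \<open>At \<open>l = s\<^sup>2\<close> this polynomial is
    \<open>h\<^sup>2 * (l + \<nu>)\<^sup>2 - l\<close>; its nonnegativity is the squared form of the
    bound on \<open>s / (\<nu> + s\<^sup>2)\<close>.\<close>
  have "0 \<le> h\<^sup>2 * (norm ?g)\<^sup>2 + (2 * \<nu> * h\<^sup>2 - 1) * (norm (J *v z))\<^sup>2 + (h\<^sup>2 * \<nu>\<^sup>2) * (norm z)\<^sup>2"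
  proof (rule gram_quadratic_nonneg)
    fix s assume s: "s \<in> singular_values J" "0 \<le> s"
    have "\<nu> + s\<^sup>2 > 0" using assms(1) by (simp add: add_pos_nonneg)
    then have "s \<le> h * (\<nu> + s\<^sup>2)"
      using assms(3) s(1) by (simp add: divide_le_eq)
    then have "s\<^sup>2 \<le> (h * (\<nu> + s\<^sup>2))\<^sup>2"
      using s(2) by (rule power_mono)
    then show "0 \<le> h\<^sup>2 * (s\<^sup>2)\<^sup>2 + (2 * \<nu> * h\<^sup>2 - 1) * s\<^sup>2 + h\<^sup>2 * \<nu>\<^sup>2"
      by (simp add: power2_eq_square algebra_simps)
  qed
  also have "\<dots> = (h * norm (?g + \<nu> *\<^sub>R z))\<^sup>2 - (norm (J *v z))\<^sup>2"
    unfolding power_mult_distrib power2_norm_eq_inner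
    by (simp add: power2_norm_eq_inner inner_simps inner_vector_matrix dot_lmul_matrix
        power2_eq_square algebra_simps)
  finally have "(norm (J *v z))\<^sup>2 \<le> (h * norm (?g + \<nu> *\<^sub>R z))\<^sup>2"
    by simp
  then have "norm (J *v z) \<le> h * norm (?g + \<nu> *\<^sub>R z)"
    using assms(2) by (auto intro: power2_le_imp_le)
  then show ?thesis by (simp add: regularized_gram_vector)
qed

text \<open>\<open>x\<close> minimises the regularised least-squares functional, whose value at 0 is
  the square of \<open>norm e\<close>. Concretely, the normal equation makes
  \<open>?r \<bullet> (J *v x)\<close> nonpositive.\<close>

lemma regularized_residual_norm_le:
  fixes J :: "real^'p^'m"
  assumes "\<nu> > 0" and x: "(transpose J ** J + \<nu> *\<^sub>R mat 1) *v x = - (transpose J *v e)"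
  shows "norm (e + J *v x) \<le> norm e"
proof -
  let ?r = "e + J *v x"
  have "transpose J *v ?r = - \<nu> *\<^sub>R x"
    using x unfolding regularized_gram_vector matrix_vector_right_distrib
    by (simp add: eq_neg_iff_add_eq_0 add_ac)
  then have "?r \<bullet> (J *v x) = - \<nu> * (x \<bullet> x)"
    using dot_lmul_matrix[of ?r J x] by simp
  then have "(norm ?r)\<^sup>2 = ?r \<bullet> e - \<nu> * (x \<bullet> x)"
    by (simp add: power2_norm_eq_inner inner_add_right)
  also have "\<dots> \<le> ?r \<bullet> e" using assms(1) by simp
  also have "\<dots> \<le> norm ?r * norm e" by (rule norm_cauchy_schwarz)
  finally show ?thesis
    by (cases "?r = 0") (auto simp: power2_eq_square)
qed

lemma norm_mult_le_spectral_norm: "norm (A *v x) \<le> spectral_norm A * norm x"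
  unfolding spectral_norm_def by (simp add: onorm)

theorem proposition1:
  fixes H Hhat :: "real^'n^'m"
    and \<mu> :: "real^'p \<Rightarrow> real^'n" and p :: "real^'p"
    and D :: "real^'p^'n"
    and J Jbar E\<^sub>J :: "real^'p^'m"
    and R :: nat
    and \<epsilon> :: "real^'m" and \<nu> :: real
    and \<delta>p \<delta>pbar :: "real^'p"
    and \<sigma>1 \<sigma>Np :: real
  assumes R: "R = rank Hhat"
    and \<mu>: "\<mu> differentiable (at p)"
    and D: "D = jacobian \<mu> (at p)"
    and full_rank: "rank D = min CARD('n) CARD('p)"
    and Np_le_R: "CARD('p) \<le> R"
    and J: "J = - (H ** D)"
    and Jbar: "Jbar = - (Hhat ** D)"
    and E\<^sub>J: "E\<^sub>J = J - Jbar"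
    and \<nu>: "\<nu> > 0"
    and \<delta>p: "(transpose J ** J + \<nu> *\<^sub>R mat 1) *v \<delta>p = - (transpose J *v \<epsilon>)"
    and \<delta>pbar: "(transpose Jbar ** Jbar + \<nu> *\<^sub>R mat 1) *v \<delta>pbar = - (transpose Jbar *v \<epsilon>)"
    and \<sigma>_range: "0 \<le> \<sigma>Np" "\<sigma>Np \<le> \<sigma>1"
    and \<sigma>_bounds: "\<forall>s \<in> singular_values J. \<sigma>Np \<le> s \<and> s \<le> \<sigma>1"
  shows "norm (\<delta>p - \<delta>pbar)
    \<le> (eta \<sigma>Np \<sigma>1 \<nu> * norm \<delta>pbar + norm \<epsilon> / (\<nu> + \<sigma>Np\<^sup>2)) * spectral_norm E\<^sub>J"
proof -
  let ?A = "transpose J ** J + \<nu> *\<^sub>R mat 1"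
  let ?h = "eta \<sigma>Np \<sigma>1 \<nu>"
  let ?k = "\<nu> + \<sigma>Np\<^sup>2"
  define r where "r = \<epsilon> + Jbar *v \<delta>pbar"
  define d where "d = \<delta>p - \<delta>pbar"
  have k: "?k > 0" using \<nu> by (simp add: add_pos_nonneg)
  have h_bound: "s / (\<nu> + s\<^sup>2) \<le> ?h" if "\<sigma>Np \<le> s" "s \<le> \<sigma>1" for s
    using eta_max(2)[OF \<sigma>_range(2) \<nu>] that by blast
  have h0: "0 \<le> ?h"
    using h_bound[of \<sigma>Np] \<sigma>_range k by (smt (verit) divide_nonneg_pos)
  have A_ge: "?k * norm z \<le> norm (?A *v z)" for z
    using \<sigma>_range(1) \<sigma>_bounds by (intro norm_regularized_gram_ge) auto
  have J_le: "norm (J *v z) \<le> ?h * norm (?A *v z)" for z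
    using \<nu> h0 \<sigma>_bounds h_bound by (intro norm_le_regularized_gram) auto
  have r_le: "norm r \<le> norm \<epsilon>"
    unfolding r_def using \<nu> \<delta>pbar by (rule regularized_residual_norm_le)
  \<comment> \<open>Since \<open>\<epsilon> + J *v \<delta>pbar\<close> equals
    \<open>r + E\<^sub>J *v \<delta>pbar\<close>, the terms in \<open>Jbar\<close> combine with
    those in \<open>J\<close> so that each remaining term has a factor \<open>E\<^sub>J\<close> or
    its transpose.\<close>
  have Ad: "?A *v d = - (transpose E\<^sub>J *v r) - transpose J *v (E\<^sub>J *v \<delta>pbar)"
  proof -
    have "\<nu> *\<^sub>R \<delta>pbar = - (transpose Jbar *v r)"
      using \<delta>pbar unfolding regularized_gram_vector r_def matrix_vector_right_distrib
      by (simp add: algebra_simps add_eq_0_iff)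
    moreover have "J = E\<^sub>J + Jbar" "transpose E\<^sub>J = transpose J - transpose Jbar"
      using E\<^sub>J by (simp_all add: transpose_def vec_eq_iff)
    ultimately show ?thesis
      using \<delta>p unfolding d_def matrix_vector_mult_diff_distrib regularized_gram_vector r_def
      by (simp add: matrix_vector_right_distrib matrix_vector_mult_diff_rdistrib
          matrix_vector_mult_add_rdistrib algebra_simps)
  qed
  \<comment> \<open>Pairing \<open>?A *v d\<close> with a solution \<open>z\<close> of
    \<open>?A *v z = d\<close> moves both transposes onto \<open>z\<close>, so only the norm of
    \<open>E\<^sub>J\<close> itself is needed, not that of its transpose.\<close>
  have "inj ((*v) ?A)"
  proof (subst linear_injective_0, rule matrix_vector_mul_linear, intro allI impI)
    fix z assume "?A *v z = 0"
    then show "z = 0" using A_ge[of z] k by (simp add: mult_le_0_iff)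
  qed
  then have "surj ((*v) ?A)"
    by (intro linear_injective_imp_surjective) auto
  then obtain z where z: "?A *v z = d" by (metis surjD)
  have sym: "d \<bullet> (?A *v z) = (?A *v d) \<bullet> z"
    unfolding regularized_gram_vector by (simp add: inner_simps inner_vector_matrix dot_lmul_matrix)
  have "(norm d)\<^sup>2 = (?A *v d) \<bullet> z"
    using sym z by (simp add: power2_norm_eq_inner)
  also have "\<dots> = - (r \<bullet> (E\<^sub>J *v z)) - (E\<^sub>J *v \<delta>pbar) \<bullet> (J *v z)"
    unfolding Ad by (simp add: inner_simps dot_lmul_matrix)
  also have "\<dots> \<le> norm r * norm (E\<^sub>J *v z) + norm (E\<^sub>J *v \<delta>pbar) * norm (J *v z)"
    using Cauchy_Schwarz_ineq2[of r "E\<^sub>J *v z"] Cauchy_Schwarz_ineq2[of "E\<^sub>J *v \<delta>pbar" "J *v z"]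
    by linarith
  \<comment> \<open>The bound on \<open>z\<close> yields the residual term, and the bound on
    \<open>J *v z\<close> yields the \<open>eta\<close> term.\<close>
  also have "\<dots> \<le> norm \<epsilon> * (spectral_norm E\<^sub>J * (norm d / ?k))
      + (spectral_norm E\<^sub>J * norm \<delta>pbar) * (?h * norm d)"
  proof (intro add_mono mult_mono)
    have E0: "0 \<le> spectral_norm E\<^sub>J"
      unfolding spectral_norm_def by (simp add: onorm_pos_le)
    have "norm z \<le> norm d / ?k"
      using A_ge[of z] z k by (simp add: pos_le_divide_eq mult.commute)
    then show "norm (E\<^sub>J *v z) \<le> spectral_norm E\<^sub>J * (norm d / ?k)"
      using norm_mult_le_spectral_norm[of E\<^sub>J z] E0 by (meson mult_left_mono order_trans)
    show "0 \<le> spectral_norm E\<^sub>J * norm \<delta>pbar" using E0 by simp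
  qed (use r_le J_le[of z] z norm_mult_le_spectral_norm in auto)
  also have "\<dots> = norm d * ((?h * norm \<delta>pbar + norm \<epsilon> / ?k) * spectral_norm E\<^sub>J)"
    by (simp add: algebra_simps)
  finally have main: "norm d * norm d
      \<le> norm d * ((?h * norm \<delta>pbar + norm \<epsilon> / ?k) * spectral_norm E\<^sub>J)"
    by (simp add: power2_eq_square)
  \<comment> \<open>Needed for \<open>d = 0\<close>, where the factor \<open>norm d\<close> cannot
    be cancelled.\<close>
  have "0 \<le> (?h * norm \<delta>pbar + norm \<epsilon> / ?k) * spectral_norm E\<^sub>J"
    using h0 k by (simp add: spectral_norm_def onorm_pos_le)
  with main show ?thesis
    unfolding d_def[symmetric] by (cases "d = 0") auto
qed

end
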